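(* Let $P_0,P_1$ be probability measures on a measurable space $\mathcal Y$, let $\alpha\in[0,1]$, $Q_\alpha=(1-\alpha)P_0+\alpha P_1$, and let $f:\mathcal Y\to[0,1]$ be a measurable function fixed independently of all samples below. Let $m,n_0,n_1\ge1$ and let $$\bar f_A=\frac1m\sum_{i=1}^m f(Y_i^A),\qquad \bar f_0=\frac1{n_0}\sum_{j=1}^{n_0} f(Y_j^0),\qquad \bar f_1=\frac1{n_1}\sum_{k=1}^{n_1} f(Y_k^1),$$ where $Y_i^A\sim Q_\alpha$ ($1\le i\le m$), $Y_j^0\sim P_0$ ($1\le j\le n_0$), $Y_k^1\sim P_1$ ($1\le k\le n_1$) are i.i.d. samples that are mutually independent. For $\delta\in(0,1)$ define $$\varepsilon(n)=\sqrt{\frac{\log(6/\delta)}{2n}},$$ $$N_L=(\bar f_A-\varepsilon(m))-(\bar f_0+\varepsilon(n_0)),\qquad D_U=(\bar f_1+\varepsilon(n_1))-(\bar f_0-\varepsilon(n_0)),$$ and $$\underline\alpha=\begin{cases}\min\{1,\max\{0,N_L/D_U\}\},&D_U>0,\\ 0,&D_U\le0.\end{cases}$$ Then $$\mathbb P\{\underline\alpha\le\alpha\}\ge1-\delta .$$ *)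

theory Defs
  imports "HOL-Probability.Probability"
begin

text \<open>Meaningful only for \<open>0 \<le> a \<le> 1\<close> and \<open>sets P1 = sets P0\<close>:
  \<open>ennreal\<close> truncates negative weights to 0.\<close>

definition mixture :: "real \<Rightarrow> 'y measure \<Rightarrow> 'y measure \<Rightarrow> 'y measure" where
  "mixture a P0 P1 = measure_of (space P0) (sets P0)
     (\<lambda>B. ennreal (1 - a) * emeasure P0 B + ennreal a * emeasure P1 B)"

lemma sets_mixture [simp]: "sets (mixture a P0 P1) = sets P0"
  by (simp add: mixture_def sets.space_closed sets.sigma_sets_eq)

lemma space_mixture [simp]: "space (mixture a P0 P1) = space P0"
  by (simp add: mixture_def sets.space_closed space_measure_of)

lemma emeasure_mixture:
  assumes "sets P1 = sets P0" and "B \<in> sets P0"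
  shows "emeasure (mixture a P0 P1) B
           = ennreal (1 - a) * emeasure P0 B + ennreal a * emeasure P1 B"
proof (rule emeasure_measure_of[OF mixture_def])
  show "countably_additive (sets (mixture a P0 P1))
          (\<lambda>B. ennreal (1 - a) * emeasure P0 B + ennreal a * emeasure P1 B)"
  proof (rule countably_additiveI)
    fix A :: "nat \<Rightarrow> 'a set"
    assume A: "range A \<subseteq> sets (mixture a P0 P1)" "disjoint_family A"
    have 0: "range A \<subseteq> sets P0" and 1: "range A \<subseteq> sets P1"
      using A assms(1) by auto
    show "(\<Sum>i. ennreal (1 - a) * emeasure P0 (A i) + ennreal a * emeasure P1 (A i))
        = ennreal (1 - a) * emeasure P0 (\<Union>i. A i) + ennreal a * emeasure P1 (\<Union>i. A i)"
      by (simp add: suminf_add[symmetric] suminf_emeasure[OF 0 A(2)] suminf_emeasure[OF 1 A(2)])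
  qed
qed (use assms in \<open>auto simp: positive_def sets.space_closed dest: sets.sets_into_space\<close>)

definition sample_mean :: "('y \<Rightarrow> real) \<Rightarrow> (nat \<Rightarrow> 'w \<Rightarrow> 'y) \<Rightarrow> nat \<Rightarrow> 'w \<Rightarrow> real" where
  "sample_mean f Y n \<omega> = (\<Sum>i=1..n. f (Y i \<omega>)) / real n"

definition conf_radius :: "real \<Rightarrow> nat \<Rightarrow> real" where
  "conf_radius \<delta> n = sqrt (ln (6 / \<delta>) / (2 * real n))"

definition num_lower :: "real \<Rightarrow> nat \<Rightarrow> nat \<Rightarrow> real \<Rightarrow> real \<Rightarrow> real" where
  "num_lower \<delta> m n0 fA f0 = (fA - conf_radius \<delta> m) - (f0 + conf_radius \<delta> n0)"

definition den_upper :: "real \<Rightarrow> nat \<Rightarrow> nat \<Rightarrow> real \<Rightarrow> real \<Rightarrow> real" where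
  "den_upper \<delta> n0 n1 f0 f1 = (f1 + conf_radius \<delta> n1) - (f0 - conf_radius \<delta> n0)"

definition alpha_lower :: "real \<Rightarrow> real \<Rightarrow> real" where
  "alpha_lower N D = (if D > 0 then min 1 (max 0 (N / D)) else 0)"

end

theory Submission
  imports Defs
begin

text \<open>By Hoeffding's inequality and the choice of the radius, each of the three sample means deviates
  from its expectation by at least its radius with probability at most \<open>\<delta> / 3\<close>. Outside these three
  events, with \<open>\<mu>0\<close> and \<open>\<mu>1\<close> the means of \<open>f\<close> under \<open>P0\<close> and \<open>P1\<close>, the numerator is at most
  \<open>\<alpha> * (\<mu>1 - \<mu>0)\<close> and the denominator is at least \<open>\<mu>1 - \<mu>0\<close>, so the numerator is at most \<open>\<alpha>\<close> times
  the denominator.\<close>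

text \<open>Induction over nonnegative measurable functions: \<open>emeasure_mixture\<close> is the
  indicator case, and both sides are linear in \<open>f\<close> and continuous along increasing
  sequences.\<close>

lemma nn_integral_mixture:
  assumes sets: "sets P1 = sets P0" and f: "f \<in> borel_measurable P0"
  shows "(\<integral>\<^sup>+y. f y \<partial>mixture a P0 P1)
           = ennreal (1 - a) * (\<integral>\<^sup>+y. f y \<partial>P0) + ennreal a * (\<integral>\<^sup>+y. f y \<partial>P1)"
proof -
  \<comment> \<open>The induction supplies measurability for \<open>P0\<close> only; the integral
    rules are applied to all three measures, which share their measurable sets.\<close>
  have meas: "g \<in> borel_measurable N"
    if "g \<in> borel_measurable P0" "N \<in> {P0, P1, mixture a P0 P1}"
    for g :: "'a \<Rightarrow> ennreal" and N
  proof -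
    have "sets N = sets P0"
      using that(2) by (elim insertE) (simp_all add: sets)
    then show ?thesis
      using that(1) measurable_cong_sets[of N P0 borel borel] by simp
  qed
  show ?thesis
    using f
  proof (induction f rule: borel_measurable_induct)
    case (cong f g)
    have "space P1 = space P0"
      using sets by (rule sets_eq_imp_space_eq)
    then show ?case
      using cong by (simp cong: nn_integral_cong_simp)
  next
    case (set A)
    then show ?case
      by (simp add: sets emeasure_mixture)
  next
    case (mult u c)
    have "(\<integral>\<^sup>+y. c * u y \<partial>N) = c * integral\<^sup>N N u" if "N \<in> {P0, P1, mixture a P0 P1}" for N
      by (rule nn_integral_cmult[OF meas[OF mult.hyps(2) that]])
    then show ?case
      by (simp add: mult.IH distrib_left ac_simps)
  next
    case (add u v)
    have "(\<integral>\<^sup>+y. v y + u y \<partial>N) = integral\<^sup>N N v + integral\<^sup>N N u"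
      if "N \<in> {P0, P1, mixture a P0 P1}" for N
      by (rule nn_integral_add[OF meas[OF add.hyps(3) that] meas[OF add.hyps(1) that]])
    then show ?case
      by (simp add: add.IH distrib_left ac_simps)
  next
    case (seq U)
    have "(\<integral>\<^sup>+y. (SUP i. U i y) \<partial>N) = (SUP i. integral\<^sup>N N (U i))"
      if "N \<in> {P0, P1, mixture a P0 P1}" for N
      using nn_integral_monotone_convergence_SUP[OF \<open>incseq U\<close> meas[OF seq.hyps(1) that]]
      by (simp add: image_image)
    \<comment> \<open>Monotonicity is what allows the sum of the two suprema to be merged into one
      supremum of sums.\<close>
    moreover have "incseq (\<lambda>i. c * integral\<^sup>N N (U i))" for c N
      using \<open>incseq U\<close> by (auto simp: incseq_def le_fun_def intro!: mult_left_mono nn_integral_mono)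
    ultimately show ?case
      by (simp add: seq.IH image_image SUP_mult_left_ennreal ennreal_SUP_add)
  qed
qed

text \<open>Reduces to the nonnegative integral. Integrability makes both component integrals
  finite, and \<open>a\<close> in [0,1] keeps the weights from being truncated, so
  \<open>enn2real\<close> returns the real combination.\<close>

lemma integral_mixture:
  assumes sets: "sets P1 = sets P0" and f: "f \<in> borel_measurable P0"
    and nonneg: "\<And>y. y \<in> space P0 \<Longrightarrow> 0 \<le> f y"
    and int: "integrable P0 f" "integrable P1 f"
    and a: "0 \<le> a" "a \<le> 1"
  shows "(\<integral>y. f y \<partial>mixture a P0 P1) = (1 - a) * (\<integral>y. f y \<partial>P0) + a * (\<integral>y. f y \<partial>P1)"
proof -
  have sp: "space P1 = space P0"
    using sets by (rule sets_eq_imp_space_eq)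
  have I: "0 \<le> (\<integral>y. f y \<partial>P0)" "0 \<le> (\<integral>y. f y \<partial>P1)"
    using nonneg sp by (auto intro!: integral_nonneg_AE)
  have N: "(\<integral>\<^sup>+y. ennreal (f y) \<partial>P0) = ennreal (\<integral>y. f y \<partial>P0)"
      "(\<integral>\<^sup>+y. ennreal (f y) \<partial>P1) = ennreal (\<integral>y. f y \<partial>P1)"
    using nonneg sp int by (auto intro!: nn_integral_eq_integral)
  have "(\<integral>y. f y \<partial>mixture a P0 P1) = enn2real (\<integral>\<^sup>+y. ennreal (f y) \<partial>mixture a P0 P1)"
    using f nonneg by (intro integral_eq_nn_integral)
      (auto simp: measurable_cong_sets[OF sets_mixture refl])
  also have "(\<integral>\<^sup>+y. ennreal (f y) \<partial>mixture a P0 P1)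
      = ennreal (1 - a) * ennreal (\<integral>y. f y \<partial>P0) + ennreal a * ennreal (\<integral>y. f y \<partial>P1)"
    using f by (simp add: nn_integral_mixture[OF sets] N)
  also have "\<dots> = ennreal ((1 - a) * (\<integral>y. f y \<partial>P0) + a * (\<integral>y. f y \<partial>P1))"
    using a I by (simp add: ennreal_mult ennreal_plus)
  finally show ?thesis
    using a I by (simp del: ennreal_plus)
qed

lemma (in prob_space) indep_vars_reindex:
  assumes g: "inj_on g J" and X: "indep_vars N X (g ` J)"
  shows "indep_vars (\<lambda>j. N (g j)) (\<lambda>j. X (g j)) J"
  unfolding indep_vars_def2
proof (intro conjI ballI indep_setsI)
  show rv: "random_variable (N (g j)) (X (g j))" if "j \<in> J" for j
    using X that by (auto simp: indep_vars_def2)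
  show "{X (g j) -` A \<inter> space M |A. A \<in> sets (N (g j))} \<subseteq> events" if "j \<in> J" for j
    using measurable_sets[OF rv[OF that]] by auto
next
  fix A K
  assume K: "K \<noteq> {}" "K \<subseteq> J" "finite K"
    and A: "\<forall>j\<in>K. A j \<in> {X (g j) -` B \<inter> space M |B. B \<in> sets (N (g j))}"
  \<comment> \<open>The chosen events, relabelled by the image indices.\<close>
  define A' where "A' i = A (inv_into K g i)" for i
  have gK: "inj_on g K"
    using g K(2) by (rule inj_on_subset)
  then have A': "A' (g j) = A j" if "j \<in> K" for j
    using that by (simp add: A'_def)
  have "prob (\<Inter>i\<in>g ` K. A' i) = (\<Prod>i\<in>g ` K. prob (A' i))"
  proof (rule indep_setsD)
    show "indep_sets (\<lambda>i. {X i -` B \<inter> space M |B. B \<in> sets (N i)}) (g ` J)"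
      using X by (simp add: indep_vars_def2)
    show "\<forall>i\<in>g ` K. A' i \<in> {X i -` B \<inter> space M |B. B \<in> sets (N i)}"
      using A by (simp add: A')
  qed (use K in auto)
  then show "prob (\<Inter>j\<in>K. A j) = (\<Prod>j\<in>K. prob (A j))"
    by (simp add: A' prod.reindex[OF gK] image_image cong: INF_cong_simp)
qed

lemma (in prob_space) prob_sample_mean_deviation:
  fixes Y :: "nat \<Rightarrow> 'a \<Rightarrow> 'b"
  assumes indep: "indep_vars (\<lambda>_. S) Y {1..n}" and n: "n \<ge> 1"
    and distr: "\<And>i. i \<in> {1..n} \<Longrightarrow> distr M S (Y i) = D"
    and f: "f \<in> borel_measurable S" "\<And>y. y \<in> space S \<Longrightarrow> 0 \<le> f y \<and> f y \<le> 1"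
    and \<delta>: "0 < \<delta>" "\<delta> \<le> 6"
  shows "prob {\<omega> \<in> space M. \<bar>sample_mean f Y n \<omega> - (\<integral>y. f y \<partial>D)\<bar> \<ge> conf_radius \<delta> n} \<le> \<delta> / 3"
proof -
  have Y: "Y i \<in> measurable M S" if "i \<in> {1..n}" for i
    using indep that by (auto simp: indep_vars_def)
  have Y1: "Y 1 \<in> measurable M S"
    using Y n by simp
  \<comment> \<open>The locale compares all variables with one reference variable; the first sample
    point serves, as \<open>n \<ge> 1\<close>.\<close>
  interpret Hoeffding_ineq_iid M "{1..n}" "\<lambda>i \<omega>. f (Y i \<omega>)" "\<lambda>\<omega>. f (Y 1 \<omega>)" 0 1 "\<integral>y. f y \<partial>D"
  proof unfold_locales
    show "indep_vars (\<lambda>_. borel) (\<lambda>i \<omega>. f (Y i \<omega>)) {1..n}"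
      by (rule indep_vars_compose2[OF indep]) (rule f)
    show "distr M borel (\<lambda>\<omega>. f (Y i \<omega>)) = distr M borel (\<lambda>\<omega>. f (Y 1 \<omega>))" if "i \<in> {1..n}" for i
      using distr_distr[OF f(1) Y[OF that]] distr_distr[OF f(1) Y1] distr[OF that] distr[of 1] n
      by (simp add: comp_def)
    show "(\<lambda>\<omega>. f (Y 1 \<omega>)) \<in> borel_measurable M"
      using measurable_compose[OF Y1 f(1)] .
    show "AE \<omega> in M. f (Y 1 \<omega>) \<in> {0..1}"
      using measurable_space[OF Y1] f(2) by auto
    show "(\<integral>y. f y \<partial>D) \<equiv> expectation (\<lambda>\<omega>. f (Y 1 \<omega>))"
      using integral_distr[OF Y1 f(1)] distr[of 1] n by simp
  qed auto
  have ln: "0 \<le> ln (6 / \<delta>)"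
    using \<delta> by simp
  then have "2 * real n * (conf_radius \<delta> n)\<^sup>2 = ln (6 / \<delta>)"
    using n by (simp add: conf_radius_def)
  \<comment> \<open>The 6 in the radius is two tails times three samples: the two-sided bound is
    \<open>2 * (\<delta> / 6)\<close>.\<close>
  then have "2 * exp (-2 * real n * (conf_radius \<delta> n)\<^sup>2) = \<delta> / 3"
    using \<delta> by (simp add: exp_minus)
  moreover have "conf_radius \<delta> n \<ge> 0"
    using ln by (simp add: conf_radius_def)
  ultimately show ?thesis
    using Hoeffding_ineq_abs_ge'[of "conf_radius \<delta> n"] n by (simp add: sample_mean_def)
qed

text \<open>If \<open>D > 0\<close>, divide \<open>N \<le> a * D\<close> by \<open>D\<close>;
  clipping at 0 is harmless since \<open>0 \<le> a\<close>, and clipping at 1 only lowers the value.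
  If \<open>D \<le> 0\<close>, the default value 0 is at most \<open>a\<close>. The sign of
  \<open>d\<close> is arbitrary, as a difference of means may be negative.\<close>

lemma alpha_lower_le:
  assumes "0 \<le> a" and "N \<le> a * d" and "d \<le> D"
  shows "alpha_lower N D \<le> a"
proof -
  have "N \<le> a * D"
    using assms mult_left_mono[of d D a] by linarith
  then show ?thesis
    using assms(1) by (auto simp: alpha_lower_def min_le_iff_disj pos_divide_le_eq)
qed

text \<open>The deterministic part, applied at each outcome. The numerator needs \<open>x0\<close>
  not too small and the denominator needs \<open>x0\<close> not too large, so the deviation of
  \<open>x0\<close> is controlled on both sides.\<close>

lemma alpha_lower_conf_le:
  assumes a: "0 \<le> a" and \<mu>A: "\<mu>A = (1 - a) * \<mu>0 + a * \<mu>1"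
    and "\<bar>xA - \<mu>A\<bar> < conf_radius \<delta> m"
    and "\<bar>x0 - \<mu>0\<bar> < conf_radius \<delta> n0"
    and "\<bar>x1 - \<mu>1\<bar> < conf_radius \<delta> n1"
  shows "alpha_lower (num_lower \<delta> m n0 xA x0) (den_upper \<delta> n0 n1 x0 x1) \<le> a"
proof (rule alpha_lower_le[OF a])
  have "a * (\<mu>1 - \<mu>0) = \<mu>A - \<mu>0"
    by (simp add: \<mu>A algebra_simps)
  then show "num_lower \<delta> m n0 xA x0 \<le> a * (\<mu>1 - \<mu>0)"
    using assms(3,4) by (simp add: num_lower_def)
  show "\<mu>1 - \<mu>0 \<le> den_upper \<delta> n0 n1 x0 x1"
    using assms(4,5) by (simp add: den_upper_def)
qed

theorem theorem8:
  fixes S P0 P1 :: "'y measure" and M :: "'w measure"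
    and \<alpha> \<delta> :: real and f :: "'y \<Rightarrow> real" and m n0 n1 :: nat
    and YA Y0 Y1 :: "nat \<Rightarrow> 'w \<Rightarrow> 'y"
  assumes "prob_space P0" and "sets P0 = sets S"
    and "prob_space P1" and "sets P1 = sets S"
    and "0 \<le> \<alpha>" and "\<alpha> \<le> 1"
    and "f \<in> borel_measurable S"
    and "\<And>y. y \<in> space S \<Longrightarrow> 0 \<le> f y \<and> f y \<le> 1"
    and "m \<ge> 1" and "n0 \<ge> 1" and "n1 \<ge> 1"
    and "prob_space M"
    and "prob_space.indep_vars M (\<lambda>_. S) (case_sum YA (case_sum Y0 Y1))
           ({1..m} <+> ({1..n0} <+> {1..n1}))"
    and "\<And>i. i \<in> {1..m} \<Longrightarrow> distr M S (YA i) = mixture \<alpha> P0 P1"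
    and "\<And>j. j \<in> {1..n0} \<Longrightarrow> distr M S (Y0 j) = P0"
    and "\<And>k. k \<in> {1..n1} \<Longrightarrow> distr M S (Y1 k) = P1"
    and "0 < \<delta>" and "\<delta> < 1"
  shows "measure M {\<omega> \<in> space M.
           alpha_lower
             (num_lower \<delta> m n0 (sample_mean f YA m \<omega>) (sample_mean f Y0 n0 \<omega>))
             (den_upper \<delta> n0 n1 (sample_mean f Y0 n0 \<omega>) (sample_mean f Y1 n1 \<omega>)) \<le> \<alpha>}
         \<ge> 1 - \<delta>"
proof -
  interpret P0: prob_space P0 by fact
  interpret P1: prob_space P1 by fact
  interpret M: prob_space M by fact
  note f = assms(7,8)
  have space: "space P0 = space S" "space P1 = space S"
    by (rule sets_eq_imp_space_eq; fact)+
  have fP: "f \<in> borel_measurable P0" "f \<in> borel_measurable P1"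
    using f(1) by (simp_all add: measurable_cong_sets[OF assms(2) refl]
        measurable_cong_sets[OF assms(4) refl])
  have int: "integrable P0 f" "integrable P1 f"
    using f(2) space fP
    by (auto intro!: P0.integrable_const_bound[of _ 1] P1.integrable_const_bound[of _ 1] AE_I2)
  define \<mu>A where "\<mu>A = (\<integral>y. f y \<partial>mixture \<alpha> P0 P1)"
  define \<mu>0 where "\<mu>0 = (\<integral>y. f y \<partial>P0)"
  define \<mu>1 where "\<mu>1 = (\<integral>y. f y \<partial>P1)"
  have \<mu>A: "\<mu>A = (1 - \<alpha>) * \<mu>0 + \<alpha> * \<mu>1"
    unfolding \<mu>A_def \<mu>0_def \<mu>1_def
    using assms(2,4,5,6) f(2) fP int space by (intro integral_mixture) auto

  let ?I = "{1..m} <+> ({1..n0} <+> {1..n1})"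
  let ?Y = "case_sum YA (case_sum Y0 Y1)"
  \<comment> \<open>Pulling the joint family back along the three injections into the sum type gives
    independence within each sample.\<close>
  have sub: "M.indep_vars (\<lambda>_. S) (\<lambda>i. ?Y (g i)) J"
    if "inj_on g J" "g ` J \<subseteq> ?I" for g :: "nat \<Rightarrow> nat + nat + nat" and J
    using M.indep_vars_reindex[OF that(1) M.indep_vars_subset[OF assms(13) that(2)]]
    by simp
  have indep: "M.indep_vars (\<lambda>_. S) YA {1..m}" "M.indep_vars (\<lambda>_. S) Y0 {1..n0}"
      "M.indep_vars (\<lambda>_. S) Y1 {1..n1}"
    using sub[of Inl "{1..m}"] sub[of "\<lambda>j. Inr (Inl j)" "{1..n0}"]
      sub[of "\<lambda>k. Inr (Inr k)" "{1..n1}"]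
    by (auto simp: inj_on_def Plus_def)
  have rv: "i \<in> {1..m} \<Longrightarrow> YA i \<in> measurable M S" "j \<in> {1..n0} \<Longrightarrow> Y0 j \<in> measurable M S"
      "k \<in> {1..n1} \<Longrightarrow> Y1 k \<in> measurable M S" for i j k
    using indep by (auto simp: M.indep_vars_def)
  have [measurable]: "sample_mean f YA m \<in> borel_measurable M"
      "sample_mean f Y0 n0 \<in> borel_measurable M" "sample_mean f Y1 n1 \<in> borel_measurable M"
    unfolding sample_mean_def[abs_def]
    by (intro borel_measurable_divide borel_measurable_sum borel_measurable_const
        measurable_compose[OF _ f(1)] rv; assumption)+

  \<comment> \<open>The bad events include equality, so their complements give the strict bounds of
    \<open>alpha_lower_conf_le\<close>.\<close>
  define BA where "BA = {\<omega> \<in> space M. \<bar>sample_mean f YA m \<omega> - \<mu>A\<bar> \<ge> conf_radius \<delta> m}"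
  define B0 where "B0 = {\<omega> \<in> space M. \<bar>sample_mean f Y0 n0 \<omega> - \<mu>0\<bar> \<ge> conf_radius \<delta> n0}"
  define B1 where "B1 = {\<omega> \<in> space M. \<bar>sample_mean f Y1 n1 \<omega> - \<mu>1\<bar> \<ge> conf_radius \<delta> n1}"
  let ?E = "{\<omega> \<in> space M.
      alpha_lower
        (num_lower \<delta> m n0 (sample_mean f YA m \<omega>) (sample_mean f Y0 n0 \<omega>))
        (den_upper \<delta> n0 n1 (sample_mean f Y0 n0 \<omega>) (sample_mean f Y1 n1 \<omega>)) \<le> \<alpha>}"
  have B: "BA \<in> sets M" "B0 \<in> sets M" "B1 \<in> sets M"
    unfolding BA_def B0_def B1_def by measurable
  \<comment> \<open>Monotonicity of the measure requires the larger set to be an event.\<close>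
  have E: "?E \<in> sets M"
    unfolding alpha_lower_def num_lower_def den_upper_def by measurable
  have "M.prob BA \<le> \<delta> / 3" "M.prob B0 \<le> \<delta> / 3" "M.prob B1 \<le> \<delta> / 3"
    unfolding BA_def B0_def B1_def \<mu>A_def \<mu>0_def \<mu>1_def
    by (rule M.prob_sample_mean_deviation[where S = S]; use assms(9-11,14-18) indep f in simp)+
  then have "M.prob (BA \<union> B0 \<union> B1) \<le> \<delta>"
    using B measure_Un_le[of "BA \<union> B0" M B1] measure_Un_le[of BA M B0]
    by simp
  then have "1 - \<delta> \<le> M.prob (space M - (BA \<union> B0 \<union> B1))"
    using B by (subst M.prob_compl) auto
  also have "\<dots> \<le> M.prob ?E"
  proof (rule M.finite_measure_mono[OF _ E])
    show "space M - (BA \<union> B0 \<union> B1) \<subseteq> ?E"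
      by (auto simp: BA_def B0_def B1_def not_le intro!: alpha_lower_conf_le[OF assms(5) \<mu>A])
  qed
  finally show ?thesis .
qed

end
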